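(* Let $G$ be a connected block graph that is not a complete graph, let $T_G$ be its block-cutpoint graph, and let $g:V(T_G)\to\{0,1,2\}$. Then the following are equivalent. (a) There is an R2DF $f$ of $G$ of weight $\gamma_{\{R2\}}(G)$ such that (L1) for every block $H$ of type 1 and every vertex $v\in V(H)$ that is not a cut-vertex, $f(v)\in\{0,1\}$; (L2) for every block $H$ of type 2 and every vertex $v\in V(H)$ that is not a cut-vertex, $f(v)=0$; and $g$ is the function induced by $f$, i.e. $g(v)=f(v)$ for every cut-vertex $v$ of $G$ and $g(h_H)=\sum_{v\in V(H)} f(v)-\sum_{v\in I_H} f(v)$ for every block $H$, where $I_H$ is the set of cut-vertices of $G$ lying in $H$. (b) $g$ satisfies all of the following: 1. if $H$ is a block of type 1, then $g(h_H)\in\{0,1\}$; 2. if $H$ is a block of type 0 or type 2, then $g(h_H)=0$; 3. if $v$ is a cut-vertex with $g(v)=0$, then either there is a vertex $u\ne v$ of $T_G$ at distance at most $2$ from $v$ in $T_G$ with $g(u)=2$, or there are two distinct vertices $u_1,u_2\ne v$ of $T_G$ at distance at most $2$ from $v$ in $T_G$ with $g(u_1)=g(u_2)=1$; 4. if $H$ is a block of type 1 or type 2 with $g(h_H)=0$, then either there is $u\in N_{T_G}(h_H)$ with $g(u)=2$, or there are distinct $u_1,u_2\in N_{T_G}(h_H)$ with $g(u_1)=g(u_2)=1$; 5. $\sum_{x\in V(T_G)} g(x)=\gamma_{\{R2\}}(G)$.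
   Context: For a graph $G=(V,E)$, a Roman $\{2\}$-dominating function (R2DF) is a function $f:V\to\{0,1,2\}$ such that every vertex $v$ with $f(v)=0$ satisfies $\sum_{u\in N(v)} f(u)\ge 2$; its weight is $\sum_{v\in V} f(v)$, and $\gamma_{\{R2\}}(G)$ is the minimum weight of an R2DF. A cut-vertex is a vertex whose removal increases the number of connected components. A block is a maximal connected induced subgraph without a cut-vertex; $G$ is a block graph if every block is complete. The block-cutpoint graph $T_G$ of a connected graph $G$ is the bipartite tree whose vertices are the cut-vertices of $G$ and one vertex $h_H$ per block $H$, with $v h_H$ an edge iff the cut-vertex $v$ lies in $H$. For a block $H$ with $I_H$ the set of cut-vertices of $G$ in $H$: $H$ is of type 0 if $|V(H)|=|I_H|$, of type 1 if $|V(H)|=|I_H|+1$, and of type 2 if $|V(H)|\ge |I_H|+2$. *)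

theory Defs
  imports "Graph_Theory.Graph_Theory"
begin

text \<open>
  Finite simple graphs are the symmetric digraphs of the locale \<^locale>\<open>graph\<close>: an undirected
  edge is a pair of opposite arcs, and the strongly connected components of such a digraph are
  the connected components of the undirected graph.
\<close>

definition nbhd :: "('a,'b) pre_digraph \<Rightarrow> 'a \<Rightarrow> 'a set" where
  "nbhd G v = {u. v \<rightarrow>\<^bsub>G\<^esub> u}"

definition complete_graph :: "('a,'b) pre_digraph \<Rightarrow> bool" where
  "complete_graph G \<longleftrightarrow> (\<exists>n. K\<^bsub>n\<^esub> G)"

definition graph_dist :: "('a,'b) pre_digraph \<Rightarrow> 'a \<Rightarrow> 'a \<Rightarrow> ereal" where
  "graph_dist G u v = wf_digraph.\<mu> G (\<lambda>_. 1) u v"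

definition r2df :: "('a,'b) pre_digraph \<Rightarrow> ('a \<Rightarrow> nat) \<Rightarrow> bool" where
  "r2df G f \<longleftrightarrow>
     (\<forall>v\<in>verts G. f v \<in> {0, 1, 2}) \<and>
     (\<forall>v\<in>verts G. f v = 0 \<longrightarrow> (\<Sum>u\<in>nbhd G v. f u) \<ge> 2)"

definition weight :: "('a,'b) pre_digraph \<Rightarrow> ('a \<Rightarrow> nat) \<Rightarrow> nat" where
  "weight G f = (\<Sum>v\<in>verts G. f v)"

definition gamma_R2 :: "('a,'b) pre_digraph \<Rightarrow> nat" where
  "gamma_R2 G = (LEAST w. \<exists>f. r2df G f \<and> weight G f = w)"

definition cut_vertex :: "('a,'b) pre_digraph \<Rightarrow> 'a \<Rightarrow> bool" where
  "cut_vertex G v \<longleftrightarrow> v \<in> verts G \<and>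
     card (pre_digraph.sccs (pre_digraph.del_vert G v)) > card (pre_digraph.sccs G)"

definition nonseparable :: "('a,'b) pre_digraph \<Rightarrow> bool" where
  "nonseparable H \<longleftrightarrow> connected H \<and> \<not> (\<exists>v. cut_vertex H v)"

definition blocks :: "('a,'b) pre_digraph \<Rightarrow> ('a,'b) pre_digraph set" where
  "blocks G = {H. induced_subgraph H G \<and> nonseparable H \<and>
     \<not> (\<exists>H'. induced_subgraph H' G \<and> nonseparable H' \<and> verts H \<subset> verts H')}"

definition block_graph :: "('a,'b) pre_digraph \<Rightarrow> bool" where
  "block_graph G \<longleftrightarrow> (\<forall>H\<in>blocks G. complete_graph H)"

text \<open>Cut-vertices in \<open>cuts_in G H\<close> are those of \<open>G\<close>, not those of \<open>H\<close>.\<close>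

definition cuts_in :: "('a,'b) pre_digraph \<Rightarrow> ('a,'b) pre_digraph \<Rightarrow> 'a set" where
  "cuts_in G H = {v \<in> verts H. cut_vertex G v}"

definition type0 :: "('a,'b) pre_digraph \<Rightarrow> ('a,'b) pre_digraph \<Rightarrow> bool" where
  "type0 G H \<longleftrightarrow> card (verts H) = card (cuts_in G H)"

definition type1 :: "('a,'b) pre_digraph \<Rightarrow> ('a,'b) pre_digraph \<Rightarrow> bool" where
  "type1 G H \<longleftrightarrow> card (verts H) = card (cuts_in G H) + 1"

definition type2 :: "('a,'b) pre_digraph \<Rightarrow> ('a,'b) pre_digraph \<Rightarrow> bool" where
  "type2 G H \<longleftrightarrow> card (verts H) \<ge> card (cuts_in G H) + 2"

datatype ('a,'b) bc_vertex = CutV 'a | BlockV "('a,'b) pre_digraph"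

definition block_cutpoint_graph :: "('a,'b) pre_digraph \<Rightarrow> ('a,'b) bc_vertex pair_pre_digraph" where
  "block_cutpoint_graph G =
     \<lparr> pverts = CutV ` {v. cut_vertex G v} \<union> BlockV ` blocks G,
       parcs = (\<Union>H\<in>blocks G. \<Union>v\<in>cuts_in G H. {(CutV v, BlockV H), (BlockV H, CutV v)}) \<rparr>"

text \<open>The subtraction does not truncate, since \<open>cuts_in G H \<subseteq> verts H\<close> and \<open>verts H\<close> is finite.\<close>

fun induced_fun :: "('a,'b) pre_digraph \<Rightarrow> ('a \<Rightarrow> nat) \<Rightarrow> ('a,'b) bc_vertex \<Rightarrow> nat" where
  "induced_fun G f (CutV v) = f v"
| "induced_fun G f (BlockV H) = (\<Sum>v\<in>verts H. f v) - (\<Sum>v\<in>cuts_in G H. f v)"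

end

theory Submission
  imports Defs
begin

text \<open>
  In a block graph the open neighbourhood of a vertex \<open>v\<close> is the union of the blocks through \<open>v\<close>,
  minus \<open>v\<close>, and the non-cut parts of distinct blocks are disjoint. Collapsing the non-cut part of
  each block to one tree vertex therefore preserves sums: the \<open>f\<close>-mass of \<open>N(v)\<close> is the \<open>g\<close>-mass
  of the punctured ball of radius 2 around \<open>v\<close> in the tree if \<open>v\<close> is a cut-vertex, and the
  \<open>g\<close>-mass of the neighbours of \<open>h\<^sub>H\<close> if \<open>v\<close> is a non-cut vertex of \<open>H\<close> with \<open>g(h\<^sub>H) = 0\<close>. A sum
  of values in \<open>{0,1,2}\<close> is at least 2 iff it has a summand 2 or two summands 1, so the domination
  condition on \<open>f\<close> is equivalent to conditions 3 and 4 on \<open>g\<close>. Conversely, (L1), (L2) and the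
  types determine \<open>f\<close> from \<open>g\<close>.
\<close>

section \<open>Nonseparable induced subgraphs and blocks\<close>

lemma arcs_ends_induce_subgraph: "arcs_ends (G \<restriction> S) = arcs_ends G \<inter> S \<times> S"
  by (auto simp: arcs_ends_conv)

lemma del_vert_induce_subgraph: "pre_digraph.del_vert (G \<restriction> S) v = G \<restriction> (S - {v})"
  by (auto simp: pre_digraph.del_vert_def induce_subgraph_def)

lemma vwalk_append:
  assumes "vwalk p G" "vwalk q G" "last p \<rightarrow>\<^bsub>G\<^esub> hd q"
  shows "vwalk (p @ q) G"
  using assms by (auto simp: vwalk_def vwalk_arcs_append)

lemma vwalk_induce_set: "vwalk p G \<Longrightarrow> vwalk p (G \<restriction> set p)"
  by (auto simp: vwalk_def arcs_ends_induce_subgraph dest: arcs_in_vwalk_arcs)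

lemma (in wf_digraph) vwalk_hd_reachable: "vwalk p G \<Longrightarrow> x \<in> set p \<Longrightarrow> hd p \<rightarrow>\<^sup>* x"
proof (induct arbitrary: x rule: vwalk_induct)
  case (Cons u v es)
  then show ?case by (metis adj_in_verts(1) adj_reachable_trans list.sel(1) reachable_refl set_ConsD)
qed auto

lemma (in wf_digraph) strongly_connected_card_sccs:
  "strongly_connected G \<Longrightarrow> card sccs = 1"
  by (simp add: strongly_connected_eq_iff)

text \<open>Vertices of a single component reach each other. The count 0 also meets the bound, hence
  the demand for a vertex.\<close>

lemma (in fin_digraph) strongly_connected_if_card_sccs_le_1:
  assumes "card sccs \<le> 1" "verts G \<noteq> {}"
  shows "strongly_connected G"
proof (rule strongly_connectedI)
  fix u v assume uv: "u \<in> verts G" "v \<in> verts G"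
  have "card sccs_verts \<le> 1"
    using assms(1) by (simp add: card_sccs_verts)
  then have "scc_of u = scc_of v"
    using uv finite_sccs_verts by (auto simp: card_le_Suc0_iff_eq scc_of_in_sccs_verts)
  then show "u \<rightarrow>\<^sup>* v"
    using in_scc_of_self[OF uv(2)] by (auto simp: scc_of_def)
qed fact

lemma (in wf_digraph) strongly_connected_imp_connected:
  assumes "strongly_connected G" shows "connected G"
  using assms by (auto intro!: connectedI reachable_mk_symmetricI simp: strongly_connected_def)

context graph
begin

lemma graph_induce_subgraph: "S \<subseteq> verts G \<Longrightarrow> graph (G \<restriction> S)"
  by (metis digraph.graphI digraphI_induced induced_graph_imp_symmetric induced_induce sym_arcs)

text \<open>The first vertex reaches the others along the walk, whose arcs stay inside
  \<open>set p\<close>; symmetry of the arcs gives the way back.\<close>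

lemma strongly_connected_induce_vwalk:
  assumes "vwalk p G"
  shows "strongly_connected (G \<restriction> set p)"
proof -
  interpret P: graph "G \<restriction> set p"
    using assms by (intro graph_induce_subgraph) auto
  have "hd p \<rightarrow>\<^sup>*\<^bsub>G \<restriction> set p\<^esub> x" if "x \<in> set p" for x
    using P.vwalk_hd_reachable[OF vwalk_induce_set[OF assms] that] .
  then have "x \<rightarrow>\<^sup>*\<^bsub>G \<restriction> set p\<^esub> y" if "x \<in> set p" "y \<in> set p" for x y
    using that by (meson P.reachable_trans P.symmetric_reachable')
  then show ?thesis
    using assms by (auto simp: strongly_connected_def vwalk_def)
qed

section \<open>Cliques, cycles and deletion of vertices\<close>

lemma strongly_connected_induce_clique:
  assumes "S \<subseteq> verts G" "S \<noteq> {}" "\<And>x y. x \<in> S \<Longrightarrow> y \<in> S \<Longrightarrow> x \<noteq> y \<Longrightarrow> x \<rightarrow> y"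
  shows "strongly_connected (G \<restriction> S)"
proof (rule strongly_connectedI)
  interpret S: graph "G \<restriction> S"
    using assms by (intro graph_induce_subgraph) auto
  fix u v assume "u \<in> verts (G \<restriction> S)" "v \<in> verts (G \<restriction> S)"
  then show "u \<rightarrow>\<^sup>*\<^bsub>G \<restriction> S\<^esub> v"
    using assms by (cases "u = v") (auto simp: arcs_ends_induce_subgraph)
qed (use assms in auto)

text \<open>A strongly connected graph has one component, so a cut-vertex would have to leave at
  least two. A singleton is exempt in \<open>del\<close> because deletion leaves the empty graph,
  which has no component at all.\<close>

lemma nonseparable_induceI:
  assumes "S \<subseteq> verts G" "strongly_connected (G \<restriction> S)"
    and del: "\<And>w. w \<in> S \<Longrightarrow> S \<noteq> {w} \<Longrightarrow> strongly_connected (G \<restriction> (S - {w}))"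
  shows "nonseparable (G \<restriction> S)"
proof -
  interpret S: graph "G \<restriction> S"
    using assms by (intro graph_induce_subgraph) auto
  have "\<not> cut_vertex (G \<restriction> S) w" for w
  proof
    assume cut: "cut_vertex (G \<restriction> S) w"
    then have w: "w \<in> S" by (simp add: cut_vertex_def)
    have wf: "wf_digraph (G \<restriction> (S - {w}))" by auto
    have "card (pre_digraph.sccs (G \<restriction> (S - {w}))) \<le> 1"
    proof (cases "S = {w}")
      case True
      then have "pre_digraph.sccs (G \<restriction> (S - {w})) = {}"
        by (force simp: pre_digraph.sccs_def strongly_connected_def induced_subgraph_def subgraph_def)
      then show ?thesis by simp
    next
      case False
      then show ?thesis
        using wf_digraph.strongly_connected_card_sccs[OF wf del] w by simp
    qed
    with cut show False
      using S.strongly_connected_card_sccs[OF assms(2)]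
      by (simp add: cut_vertex_def del_vert_induce_subgraph)
  qed
  then show ?thesis
    using S.strongly_connected_imp_connected[OF assms(2)] by (simp add: nonseparable_def)
qed

lemma nonseparable_clique:
  assumes "S \<subseteq> verts G" "S \<noteq> {}" "\<And>x y. x \<in> S \<Longrightarrow> y \<in> S \<Longrightarrow> x \<noteq> y \<Longrightarrow> x \<rightarrow> y"
  shows "nonseparable (G \<restriction> S)"
  using assms by (intro nonseparable_induceI strongly_connected_induce_clique) auto

text \<open>Deleting one vertex of a cycle leaves a path. For \<open>p\<close> of length 1 the cycle
  degenerates to an edge, and the same argument applies.\<close>

lemma nonseparable_cycle:
  assumes p: "vpath p G" and "v \<notin> set p" "v \<rightarrow> hd p" "last p \<rightarrow> v"
  shows "nonseparable (G \<restriction> insert v (set p))"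
proof (rule nonseparable_induceI)
  have vp: "vwalk p G" "distinct p" "p \<noteq> []" using p by auto
  show "insert v (set p) \<subseteq> verts G"
    using vp assms(3) by (auto dest: adj_in_verts)
  show "strongly_connected (G \<restriction> insert v (set p))"
    using strongly_connected_induce_vwalk[OF vwalk_wf_digraph_consI[OF vp(1) assms(3)]] by simp
  have v: "vwalk [v] G" using assms(3) by (auto simp: vwalk_def dest: adj_in_verts)
  fix w assume w: "w \<in> insert v (set p)" "insert v (set p) \<noteq> {w}"
  show "strongly_connected (G \<restriction> (insert v (set p) - {w}))"
  proof (cases "w = v")
    case True
    then show ?thesis
      using strongly_connected_induce_vwalk[OF vp(1)] assms(2) by simp
  next
    case False
    then obtain ys zs where p_eq: "p = ys @ w # zs"
      using w by (auto dest: split_list)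
    \<comment> \<open>Without \<open>w\<close>, the rest of the cycle is a walk along the part of
      \<open>p\<close> after \<open>w\<close>, through \<open>v\<close>, then along the part of
      \<open>p\<close> before \<open>w\<close>; either part may be empty.\<close>
    have zs: "vwalk (zs @ [v]) G"
    proof (cases "zs = []")
      case nonempty: False
      then have "vwalk zs G"
        using vwalkI_append_r[of zs "ys @ [w]"] vp(1) p_eq by simp
      then show ?thesis
        using vwalk_append[OF _ v] assms(4) nonempty p_eq by simp
    qed (use v in simp)
    have "vwalk (zs @ [v] @ ys) G"
    proof (cases "ys = []")
      case nonempty: False
      then have "vwalk ys G"
        using vwalkI_append_l[of ys "w # zs"] vp(1) p_eq by simp
      then show ?thesis
        using vwalk_append[OF zs] assms(3) nonempty p_eq by simp
    qed (use zs in simp)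
    moreover have "set (zs @ [v] @ ys) = insert v (set p) - {w}"
      using vp(2) p_eq False by auto
    ultimately show ?thesis
      using strongly_connected_induce_vwalk by metis
  qed
qed

text \<open>By symmetry a connected graph has one strong component; deleting a vertex that is not a
  cut-vertex leaves at most one, and some vertex remains.\<close>

lemma strongly_connected_del_noncut:
  assumes "connected G" "v \<in> verts G" "\<not> cut_vertex G v" "verts G \<noteq> {v}"
  shows "strongly_connected (del_vert v)"
proof -
  interpret D: fin_digraph "del_vert v" by (rule fin_digraph_del_vert)
  have "card sccs = 1"
    using assms(1) by (simp add: strongly_connected_card_sccs symmetric_connected_imp_strongly_connected sym_arcs)
  then show ?thesis
    using assms by (intro D.strongly_connected_if_card_sccs_le_1) (auto simp: cut_vertex_def del_vert_simps)
qed

section \<open>Existence, maximality and uniqueness of blocks\<close>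

lemma block_induced:
  assumes "H \<in> blocks G"
  shows "verts H \<subseteq> verts G" "H = G \<restriction> verts H" "nonseparable H" "verts H \<noteq> {}" "finite (verts H)"
proof -
  have ind: "induced_subgraph H G" using assms by (simp add: blocks_def)
  then show sub: "verts H \<subseteq> verts G" by auto
  show "H = G \<restriction> verts H"
    using induced_eq_verts_imp_eq[OF ind induced_induce[OF sub]] by simp
  show "nonseparable H" using assms by (simp add: blocks_def)
  then show "verts H \<noteq> {}"
    by (auto simp: nonseparable_def connected_def strongly_connected_def)
  show "finite (verts H)" using finite_subset[OF sub] by simp
qed

lemma block_maximal:
  assumes "H \<in> blocks G" "S \<subseteq> verts G" "nonseparable (G \<restriction> S)" "verts H \<subseteq> S"
  shows "verts H = S"
proof (rule ccontr)
  assume "verts H \<noteq> S"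
  then have "verts H \<subset> verts (G \<restriction> S)" using assms(4) by auto
  then show False using assms(1,3) induced_induce[OF assms(2)] unfolding blocks_def by blast
qed

lemma block_eqI: "H \<in> blocks G \<Longrightarrow> H' \<in> blocks G \<Longrightarrow> verts H = verts H' \<Longrightarrow> H = H'"
  using block_induced(2) by metis

lemma finite_blocks: "finite (blocks G)"
proof (rule finite_surj)
  show "finite (Pow (verts G))" by simp
  show "blocks G \<subseteq> (\<lambda>S. G \<restriction> S) ` Pow (verts G)"
    using block_induced(1,2) by blast
qed

text \<open>Vertex sets inducing nonseparable subgraphs are finite in number, so a maximal one lies
  above \<open>S\<close>, and it induces a block.\<close>

lemma nonseparable_in_block:
  assumes "S \<subseteq> verts G" "nonseparable (G \<restriction> S)"
  obtains H where "H \<in> blocks G" "S \<subseteq> verts H"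
proof -
  let ?F = "{R. R \<subseteq> verts G \<and> nonseparable (G \<restriction> R)}"
  have "finite ?F" by (rule finite_subset[of _ "Pow (verts G)"]) auto
  then obtain M where M: "M \<in> ?F" "S \<subseteq> M" "\<And>R. R \<in> ?F \<Longrightarrow> M \<subseteq> R \<Longrightarrow> M = R"
    using finite_has_maximal2[of ?F S] assms by auto
  have "\<not> M \<subset> verts H'" if "induced_subgraph H' G" "nonseparable H'" for H'
  proof -
    have sub: "verts H' \<subseteq> verts G" using that by auto
    have "H' = G \<restriction> verts H'"
      using induced_eq_verts_imp_eq[OF that(1) induced_induce[OF sub]] by simp
    then have "verts H' \<in> ?F" using sub that(2) by auto
    then show ?thesis using M(3) by auto
  qed
  then have "G \<restriction> M \<in> blocks G"
    using M(1) by (auto simp: blocks_def)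
  then show thesis using M(2) that by simp
qed

lemma vert_in_block:
  assumes "v \<in> verts G" obtains H where "H \<in> blocks G" "v \<in> verts H"
  using assms nonseparable_in_block[OF _ nonseparable_clique, of "{v}"] by auto

text \<open>The two ends of an edge form a clique, which is nonseparable.\<close>

lemma adj_in_block:
  assumes "u \<rightarrow> v" obtains H where "H \<in> blocks G" "u \<in> verts H" "v \<in> verts H"
proof -
  have "{u, v} \<subseteq> verts G" using assms by (auto dest: adj_in_verts)
  moreover from this have "nonseparable (G \<restriction> {u, v})"
    using assms graph_symmetric by (intro nonseparable_clique) auto
  ultimately show thesis using nonseparable_in_block that by (metis insert_subset)
qed

lemma block_adj:
  assumes "block_graph G" "H \<in> blocks G" "u \<in> verts H" "v \<in> verts H" "u \<noteq> v"
  shows "u \<rightarrow> v"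
proof -
  have "(u, v) \<in> arcs_ends H"
    using assms by (auto simp: block_graph_def complete_graph_def complete_digraph_def)
  then show ?thesis
    using block_induced(2)[OF assms(2)] dominates_induce_subgraphD by metis
qed

text \<open>
  If \<open>v\<close> is not a cut-vertex, neighbours of \<open>v\<close> in two blocks are joined by a path avoiding \<open>v\<close>;
  the resulting cycle lies in one block, which is complete. Hence the union of the two blocks
  is a clique, and maximality identifies them.
\<close>

lemma noncut_block_unique:
  assumes con: "connected G" and bg: "block_graph G" and nc: "\<not> cut_vertex G v"
    and H: "H1 \<in> blocks G" "H2 \<in> blocks G" "v \<in> verts H1" "v \<in> verts H2"
  shows "H1 = H2"
proof -
  have vG: "v \<in> verts G" using block_induced(1)[OF H(1)] H(3) by auto
  have cross: "a \<rightarrow> b" if ab: "a \<in> verts H1" "b \<in> verts H2" "a \<noteq> b" for a b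
  proof (cases "a = v \<or> b = v")
    case True
    then show ?thesis using block_adj[OF bg] H ab by blast
  next
    case False
    then have abv: "a \<in> verts G - {v}" "b \<in> verts G - {v}"
      using ab block_induced(1) H by auto
    then have "verts G \<noteq> {v}" by auto
    then have sc: "strongly_connected (del_vert v)"
      using strongly_connected_del_noncut[OF con vG nc] by simp
    then have "a \<rightarrow>\<^sup>*\<^bsub>del_vert v\<^esub> b"
      using abv by (auto simp: strongly_connected_def del_vert_simps)
    then obtain p where p: "vpath p (del_vert v)" "hd p = a" "last p = b"
      using wf_digraph.reachable_vpath_conv[OF wf_digraph_del_vert] by metis
    have pG: "vpath p G"
      using p(1) arcs_ends_mono[OF subgraph_del_vert]
      by (fastforce simp: vpath_def vwalk_def del_vert_simps)
    have "v \<notin> set p" using p(1) by (auto simp: vpath_def vwalk_def del_vert_simps)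
    moreover have "v \<rightarrow> hd p" "last p \<rightarrow> v"
      using block_adj[OF bg] H ab False p by blast+
    ultimately have "nonseparable (G \<restriction> insert v (set p))"
      using nonseparable_cycle[OF pG] by simp
    moreover have "insert v (set p) \<subseteq> verts G" using pG vG by (auto simp: vpath_def vwalk_def)
    ultimately obtain B where B: "B \<in> blocks G" "insert v (set p) \<subseteq> verts B"
      using nonseparable_in_block by metis
    have "p \<noteq> []" using pG by auto
    then have "a \<in> verts B" "b \<in> verts B"
      using B(2) p hd_in_set[of p] last_in_set[of p] by auto
    then show ?thesis using block_adj[OF bg B(1)] ab by simp
  qed
  have sub: "verts H1 \<union> verts H2 \<subseteq> verts G" using block_induced(1) H by auto
  have "nonseparable (G \<restriction> (verts H1 \<union> verts H2))"
  proof (rule nonseparable_clique[OF sub])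
    show "verts H1 \<union> verts H2 \<noteq> {}" using H by auto
    show "x \<rightarrow> y" if "x \<in> verts H1 \<union> verts H2" "y \<in> verts H1 \<union> verts H2" "x \<noteq> y" for x y
      using that cross block_adj[OF bg H(1)] block_adj[OF bg H(2)] graph_symmetric by blast
  qed
  then have "verts H1 = verts H1 \<union> verts H2" "verts H2 = verts H1 \<union> verts H2"
    using block_maximal[OF H(1) sub] block_maximal[OF H(2) sub] by auto
  then show ?thesis using block_eqI H by metis
qed

end

section \<open>The block-cutpoint graph\<close>

lemma sum_ge_2_iff:
  fixes f :: "'c \<Rightarrow> nat"
  assumes "finite A" "\<And>x. x \<in> A \<Longrightarrow> f x \<in> {0, 1, 2}"
  shows "sum f A \<ge> 2 \<longleftrightarrow>
    (\<exists>x\<in>A. f x = 2) \<or> (\<exists>x\<in>A. \<exists>y\<in>A. x \<noteq> y \<and> f x = 1 \<and> f y = 1)"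
proof
  assume ge: "sum f A \<ge> 2"
  show "(\<exists>x\<in>A. f x = 2) \<or> (\<exists>x\<in>A. \<exists>y\<in>A. x \<noteq> y \<and> f x = 1 \<and> f y = 1)"
  proof (rule ccontr)
    assume *: "\<not> ?thesis"
    then have 01: "f x = 0 \<or> f x = 1" if "x \<in> A" for x
      using assms(2)[OF that] that by auto
    \<comment> \<open>Without the value 2 the sum counts the places of value 1, and without two
      distinct such places the count is at most 1.\<close>
    have "sum f A = (\<Sum>x\<in>{x \<in> A. f x = 1}. 1)"
      using assms(1) by (intro sum.mono_neutral_cong_right) (auto dest: 01)
    also have "\<dots> = card {x \<in> A. f x = 1}" by simp
    also have "\<dots> \<le> Suc 0"
      using assms(1) * by (subst card_le_Suc0_iff_eq) auto
    finally show False using ge by simp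
  qed
next
  assume "(\<exists>x\<in>A. f x = 2) \<or> (\<exists>x\<in>A. \<exists>y\<in>A. x \<noteq> y \<and> f x = 1 \<and> f y = 1)"
  then show "sum f A \<ge> 2"
  proof (elim disjE bexE conjE)
    fix x assume "x \<in> A" "f x = 2"
    then show ?thesis using member_le_sum[of x A f] assms(1) by simp
  next
    fix x y assume "x \<in> A" "y \<in> A" "x \<noteq> y" "f x = 1" "f y = 1"
    then show ?thesis using sum_mono2[OF assms(1), of "{x, y}" f] by simp
  qed
qed

lemma (in wf_digraph) graph_dist_le_2_iff:
  "graph_dist G u v \<le> 2 \<longleftrightarrow> u = v \<and> u \<in> verts G \<or> u \<rightarrow> v \<or> (\<exists>w. u \<rightarrow> w \<and> w \<rightarrow> v)"
    (is "?L \<longleftrightarrow> ?R")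
proof -
  have cost: "awalk_cost (\<lambda>_. 1) p = length p" for p
    by (simp add: awalk_cost_def sum_list_triv)
  have "?L \<longleftrightarrow> (\<exists>p. awalk u p v \<and> length p \<le> 2)"
  proof
    assume ?L
    \<comment> \<open>The strict bound 3 replaces the infimum by an actual walk; a natural length
      below 3 is at most 2.\<close>
    then have "\<mu> (\<lambda>_. 1) u v < ereal 3"
      unfolding graph_dist_def by (rule le_less_trans) simp
    then obtain p where "awalk u p v" "ereal (length p) < ereal 3"
      unfolding \<mu>_def INF_less_iff cost by blast
    then show "\<exists>p. awalk u p v \<and> length p \<le> 2"
      by (intro exI[of _ p]) simp
  next
    assume "\<exists>p. awalk u p v \<and> length p \<le> 2"
    then obtain p where p: "awalk u p v" "length p \<le> 2" by auto
    have "graph_dist G u v \<le> length p"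
      using min_cost_le_walk_cost[OF p(1), of "\<lambda>_. 1"] by (simp add: graph_dist_def cost)
    also have "\<dots> \<le> 2" using p(2) by simp
    finally show ?L .
  qed
  also have "\<dots> \<longleftrightarrow> ?R"
  proof
    assume "\<exists>p. awalk u p v \<and> length p \<le> 2"
    then obtain p where p: "awalk u p v" "length p \<le> 2" by auto
    consider "p = []" | e where "p = [e]" | e1 e2 where "p = [e1, e2]"
      using p(2) by (cases p rule: list.exhaust; cases "tl p") auto
    then show ?R
    proof cases
      case 3
      then have "u \<rightarrow> head G e1" "head G e1 \<rightarrow> v"
        using p(1) by (auto simp: awalk_simps dest: in_arcs_imp_in_arcs_ends)
      then show ?thesis by blast
    qed (use p(1) in \<open>auto simp: awalk_simps dest: in_arcs_imp_in_arcs_ends\<close>)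
  next
    assume ?R
    then show "\<exists>p. awalk u p v \<and> length p \<le> 2"
    proof (elim disjE exE conjE)
      assume "u = v" "u \<in> verts G"
      then show ?thesis by (intro exI[of _ "[]"]) (simp add: awalk_Nil_iff)
    next
      assume "u \<rightarrow> v"
      then obtain e where "e \<in> arcs G" "tail G e = u" "head G e = v" by auto
      then show ?thesis by (intro exI[of _ "[e]"]) (auto simp: awalk_simps)
    next
      fix w assume "u \<rightarrow> w" "w \<rightarrow> v"
      then obtain e e' where "e \<in> arcs G" "tail G e = u" "head G e = w"
        "e' \<in> arcs G" "tail G e' = w" "head G e' = v" by (auto elim!: reachableE)
      then show ?thesis by (intro exI[of _ "[e, e']"]) (auto simp: awalk_simps)
    qed
  qed
  finally show ?thesis .
qed

section \<open>Vertices and arcs of the block-cutpoint graph\<close>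

lemma pverts_block_cutpoint_graph:
  "pverts (block_cutpoint_graph G) = CutV ` {v. cut_vertex G v} \<union> BlockV ` blocks G"
  by (simp add: block_cutpoint_graph_def)

lemma parcs_block_cutpoint_graph [simp]:
  "(CutV v, BlockV H) \<in> parcs (block_cutpoint_graph G) \<longleftrightarrow> H \<in> blocks G \<and> v \<in> cuts_in G H"
  "(BlockV H, CutV v) \<in> parcs (block_cutpoint_graph G) \<longleftrightarrow> H \<in> blocks G \<and> v \<in> cuts_in G H"
  "(CutV u, CutV v) \<notin> parcs (block_cutpoint_graph G)"
  "(BlockV H, BlockV H') \<notin> parcs (block_cutpoint_graph G)"
  by (auto simp: block_cutpoint_graph_def)

lemma wf_digraph_block_cutpoint_graph: "wf_digraph (with_proj (block_cutpoint_graph G))"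
  by unfold_locales (auto simp: block_cutpoint_graph_def cuts_in_def)

lemma nbhd_BlockV:
  assumes "H \<in> blocks G"
  shows "nbhd (with_proj (block_cutpoint_graph G)) (BlockV H) = CutV ` cuts_in G H"
proof (rule set_eqI)
  fix x
  show "x \<in> nbhd (with_proj (block_cutpoint_graph G)) (BlockV H) \<longleftrightarrow> x \<in> CutV ` cuts_in G H"
    using assms by (cases x) (auto simp: nbhd_def)
qed

section \<open>Transfer of sums between the graph and its tree\<close>

locale connected_block_graph = graph G for G :: "('a, 'b) pre_digraph" (structure) +
  assumes connected: "connected G"
    and block_graph: "block_graph G"
begin

abbreviation T :: "(('a,'b) bc_vertex, ('a,'b) bc_vertex \<times> ('a,'b) bc_vertex) pre_digraph" where
  "T \<equiv> with_proj (block_cutpoint_graph G)"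

text \<open>Every edge lies in a block, and every block is complete.\<close>

lemma nbhd_eq: "nbhd G v = (\<Union>H\<in>{H \<in> blocks G. v \<in> verts H}. verts H) - {v}"
proof (intro set_eqI iffI)
  fix u assume "u \<in> nbhd G v"
  then have vu: "v \<rightarrow> u" by (simp add: nbhd_def)
  then have "u \<noteq> v" using adj_not_same by auto
  then show "u \<in> (\<Union>H\<in>{H \<in> blocks G. v \<in> verts H}. verts H) - {v}"
    using adj_in_block[OF vu] by blast
qed (use block_adj[OF block_graph] in \<open>auto simp: nbhd_def\<close>)

lemma finite_nbhd: "finite (nbhd G v)"
  by (rule finite_subset[of _ "verts G"]) (auto simp: nbhd_def dest: adj_in_verts)

text \<open>A common element would be a non-cut vertex lying in two blocks.\<close>

lemma noncut_disjoint:
  assumes "H \<in> blocks G" "H' \<in> blocks G" "H \<noteq> H'"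
  shows "(verts H - cuts_in G H) \<inter> (verts H' - cuts_in G H') = {}"
  using noncut_block_unique[OF connected block_graph] assms by (auto simp: cuts_in_def)

lemma nbhd_noncut:
  assumes "H \<in> blocks G" "v \<in> verts H" "\<not> cut_vertex G v"
  shows "nbhd G v = verts H - {v}"
proof -
  have "{H' \<in> blocks G. v \<in> verts H'} = {H}"
    using noncut_block_unique[OF connected block_graph assms(3)] assms by auto
  then show ?thesis by (simp add: nbhd_eq)
qed

text \<open>Turns the subtraction into a sum, so that the masses of several blocks can be added over
  disjoint sets.\<close>

lemma induced_fun_BlockV:
  "H \<in> blocks G \<Longrightarrow> induced_fun G f (BlockV H) = sum f (verts H - cuts_in G H)"
  using block_induced(5)[of H]
  by (simp add: sum_diff_nat cuts_in_def)

text \<open>The masses of the blocks merge into one sum because their non-cut parts are disjoint.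
  The total weight and the mass of a ball in \<open>T\<close> are both instances.\<close>

lemma sum_CutV_BlockV:
  assumes "finite A" "B \<subseteq> blocks G"
  shows "sum (induced_fun G f) (CutV ` A \<union> BlockV ` B)
    = sum f A + sum f (\<Union>H\<in>B. verts H - cuts_in G H)"
proof -
  have fin: "finite B" using assms(2) finite_blocks finite_subset by blast
  have "sum (induced_fun G f) (CutV ` A \<union> BlockV ` B)
      = sum f A + (\<Sum>H\<in>B. induced_fun G f (BlockV H))"
    using assms(1) fin by (subst sum.union_disjoint) (auto simp: sum.reindex inj_on_def)
  also have "(\<Sum>H\<in>B. induced_fun G f (BlockV H)) = (\<Sum>H\<in>B. sum f (verts H - cuts_in G H))"
    using assms(2) by (intro sum.cong) (auto simp: induced_fun_BlockV simp del: induced_fun.simps)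
  also have "\<dots> = sum f (\<Union>H\<in>B. verts H - cuts_in G H)"
    using fin assms(2) noncut_disjoint block_induced(5)
    by (intro sum.UNION_disjoint[symmetric]) blast+
  finally show ?thesis .
qed

lemma weight_induced: "sum (induced_fun G f) (verts T) = weight G f"
proof -
  have "finite {v. cut_vertex G v}"
    by (rule finite_subset[OF _ finite_verts]) (auto simp: cut_vertex_def)
  then have "sum (induced_fun G f) (verts T)
      = sum f {v. cut_vertex G v} + sum f (\<Union>H\<in>blocks G. verts H - cuts_in G H)"
    by (simp add: pverts_block_cutpoint_graph sum_CutV_BlockV)
  also have "\<dots> = sum f ({v. cut_vertex G v} \<union> (\<Union>H\<in>blocks G. verts H - cuts_in G H))"
    using \<open>finite {v. cut_vertex G v}\<close> finite_blocks block_induced(5)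
    by (intro sum.union_disjoint[symmetric]) (auto simp: cuts_in_def)
  \<comment> \<open>Every vertex lies in some block, so no vertex is missed.\<close>
  also have "{v. cut_vertex G v} \<union> (\<Union>H\<in>blocks G. verts H - cuts_in G H) = verts G"
    using block_induced(1) vert_in_block
    by (auto simp: cuts_in_def cut_vertex_def) (metis (no_types, lifting))+
  finally show ?thesis by (simp add: weight_def)
qed

text \<open>One step from a cut-vertex leads to the blocks through it, a second one to the
  cut-vertices of those blocks. As blocks are complete, the latter, apart from \<open>v\<close>, are
  the neighbours of \<open>v\<close> in \<open>G\<close> that are cut-vertices.\<close>

lemma dist_ball_CutV:
  assumes "cut_vertex G v"
  shows "{u \<in> verts T. u \<noteq> CutV v \<and> graph_dist T (CutV v) u \<le> 2}
    = CutV ` {u \<in> nbhd G v. cut_vertex G u} \<union> BlockV ` {H \<in> blocks G. v \<in> verts H}"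
proof (rule set_eqI)
  \<comment> \<open>Splits the midpoint of a walk of length 2 by constructor, so that the adjacency
    rules of \<open>T\<close> can simplify each case.\<close>
  have ex: "(\<exists>w. P w) \<longleftrightarrow> (\<exists>u. P (CutV u)) \<or> (\<exists>H. P (BlockV H))"
    for P :: "('a, 'b) bc_vertex \<Rightarrow> bool"
    by (metis bc_vertex.exhaust)
  note dist = wf_digraph.graph_dist_le_2_iff[OF wf_digraph_block_cutpoint_graph]
  fix x
  show "x \<in> {u \<in> verts T. u \<noteq> CutV v \<and> graph_dist T (CutV v) u \<le> 2} \<longleftrightarrow>
    x \<in> CutV ` {u \<in> nbhd G v. cut_vertex G u} \<union> BlockV ` {H \<in> blocks G. v \<in> verts H}"
    unfolding mem_Collect_eq dist using assms
    by (cases x) (auto simp: ex pverts_block_cutpoint_graph nbhd_eq cuts_in_def)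
qed

lemma sum_dist_ball_CutV:
  assumes "cut_vertex G v"
  shows "sum (induced_fun G f) {u \<in> verts T. u \<noteq> CutV v \<and> graph_dist T (CutV v) u \<le> 2}
    = sum f (nbhd G v)"
proof -
  let ?C = "{u \<in> nbhd G v. cut_vertex G u}"
  let ?B = "{H \<in> blocks G. v \<in> verts H}"
  have "sum (induced_fun G f) {u \<in> verts T. u \<noteq> CutV v \<and> graph_dist T (CutV v) u \<le> 2}
      = sum f ?C + sum f (\<Union>H\<in>?B. verts H - cuts_in G H)"
    unfolding dist_ball_CutV[OF assms] using finite_nbhd by (intro sum_CutV_BlockV) auto
  also have "\<dots> = sum f (?C \<union> (\<Union>H\<in>?B. verts H - cuts_in G H))"
    using finite_nbhd finite_blocks block_induced(5)
    by (intro sum.union_disjoint[symmetric]) (auto simp: cuts_in_def)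
  \<comment> \<open>As a cut-vertex, \<open>v\<close> lies in no non-cut part, so removing it from
    the union of its blocks affects only the cut-vertices.\<close>
  also have "?C \<union> (\<Union>H\<in>?B. verts H - cuts_in G H) = nbhd G v"
    using assms by (auto simp: nbhd_eq cuts_in_def)
  finally show ?thesis .
qed

section \<open>Domination expressed in the tree\<close>

lemma cut_domination_iff:
  assumes v: "cut_vertex G v" and g: "\<forall>x\<in>verts T. g x \<in> {0, 1, 2}"
    and ind: "\<forall>x\<in>verts T. g x = induced_fun G f x"
  shows "sum f (nbhd G v) \<ge> 2 \<longleftrightarrow>
    (\<exists>u\<in>verts T. u \<noteq> CutV v \<and> graph_dist T (CutV v) u \<le> 2 \<and> g u = 2) \<or>
    (\<exists>u1\<in>verts T. \<exists>u2\<in>verts T. u1 \<noteq> u2 \<and> u1 \<noteq> CutV v \<and> u2 \<noteq> CutV v \<and>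
       graph_dist T (CutV v) u1 \<le> 2 \<and> graph_dist T (CutV v) u2 \<le> 2 \<and> g u1 = 1 \<and> g u2 = 1)"
proof -
  let ?D = "{u \<in> verts T. u \<noteq> CutV v \<and> graph_dist T (CutV v) u \<le> 2}"
  have "finite ?D"
    unfolding dist_ball_CutV[OF v] using finite_nbhd finite_blocks by simp
  moreover have "sum f (nbhd G v) = sum g ?D"
    unfolding sum_dist_ball_CutV[OF v, symmetric] using ind by (intro sum.cong) auto
  ultimately have "sum f (nbhd G v) \<ge> 2 \<longleftrightarrow>
      (\<exists>x\<in>?D. g x = 2) \<or> (\<exists>x\<in>?D. \<exists>y\<in>?D. x \<noteq> y \<and> g x = 1 \<and> g y = 1)"
    using g by (simp only:) (rule sum_ge_2_iff, auto)
  then show ?thesis by blast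
qed

text \<open>Mass 0 at the block vertex forces \<open>f\<close> to vanish on all non-cut vertices of
  \<open>H\<close>. Only the cut-vertices of \<open>H\<close> then contribute to the neighbourhood
  of \<open>v\<close>, and they are the neighbours of \<open>BlockV H\<close> in
  \<open>T\<close>.\<close>

lemma noncut_domination_iff:
  assumes H: "H \<in> blocks G" and v: "v \<in> verts H" "\<not> cut_vertex G v"
    and g: "\<forall>x\<in>verts T. g x \<in> {0, 1, 2}" and ind: "\<forall>x\<in>verts T. g x = induced_fun G f x"
    and zero: "g (BlockV H) = 0"
  shows "sum f (nbhd G v) \<ge> 2 \<longleftrightarrow>
    (\<exists>u\<in>nbhd T (BlockV H). g u = 2) \<or>
    (\<exists>u1\<in>nbhd T (BlockV H). \<exists>u2\<in>nbhd T (BlockV H). u1 \<noteq> u2 \<and> g u1 = 1 \<and> g u2 = 1)"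
proof -
  have sub: "CutV ` cuts_in G H \<subseteq> verts T"
    by (auto simp: pverts_block_cutpoint_graph cuts_in_def)
  have fin: "finite (cuts_in G H)" using block_induced(5)[OF H] by (simp add: cuts_in_def)
  have "induced_fun G f (BlockV H) = 0"
    using zero ind H by (simp add: pverts_block_cutpoint_graph del: induced_fun.simps)
  then have "sum f (verts H - cuts_in G H) = 0"
    by (simp only: induced_fun_BlockV[OF H])
  then have "\<forall>u\<in>verts H - cuts_in G H. f u = 0"
    using block_induced(5)[OF H] by simp
  then have "sum f (nbhd G v) = sum f (cuts_in G H)"
    unfolding nbhd_noncut[OF H v] using block_induced(5)[OF H] v
    by (intro sum.mono_neutral_right) (auto simp: cuts_in_def)
  also have "\<dots> = sum g (CutV ` cuts_in G H)"
    using ind sub by (subst sum.reindex) (auto simp: inj_on_def intro!: sum.cong)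
  finally have sum_eq: "sum f (nbhd G v) = sum g (CutV ` cuts_in G H)" .
  show ?thesis
    unfolding nbhd_BlockV[OF H] sum_eq
  proof (rule sum_ge_2_iff)
    show "finite (CutV ` cuts_in G H)" using fin by simp
    show "g x \<in> {0, 1, 2}" if "x \<in> CutV ` cuts_in G H" for x
      using g sub that by (meson subsetD)
  qed
qed

section \<open>Block types and the mass of a block\<close>

lemma type_cases:
  assumes "H \<in> blocks G"
  shows "type0 G H \<or> type1 G H \<or> type2 G H"
proof -
  have "card (cuts_in G H) \<le> card (verts H)"
    using block_induced(5)[OF assms] by (intro card_mono) (auto simp: cuts_in_def)
  then show ?thesis unfolding type0_def type1_def type2_def by linarith
qed

lemma type0_noncut:
  assumes "H \<in> blocks G" "type0 G H"
  shows "verts H - cuts_in G H = {}"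
  using assms block_induced(5)[OF assms(1)] card_subset_eq[of "verts H" "cuts_in G H"]
  by (auto simp: type0_def cuts_in_def)

lemma type1_noncut:
  assumes "H \<in> blocks G" "type1 G H"
  obtains w where "verts H - cuts_in G H = {w}"
proof -
  have "finite (cuts_in G H)" "cuts_in G H \<subseteq> verts H"
    using block_induced(5)[OF assms(1)] by (auto simp: cuts_in_def)
  then have "card (verts H - cuts_in G H) = 1"
    using assms(2) by (simp add: card_Diff_subset type1_def)
  then show thesis using that by (auto simp: card_1_singleton_iff)
qed

lemma type2_noncut:
  assumes "H \<in> blocks G" "type2 G H"
  obtains w where "w \<in> verts H - cuts_in G H"
proof -
  have "verts H \<noteq> cuts_in G H" using assms(2) by (auto simp: type2_def)
  then show thesis using that by (auto simp: cuts_in_def)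
qed

lemma induced_fun_type0:
  "H \<in> blocks G \<Longrightarrow> type0 G H \<Longrightarrow> induced_fun G f (BlockV H) = 0"
  by (simp only: induced_fun_BlockV type0_noncut sum.empty)

text \<open>A type 1 block has a single non-cut vertex, which carries its whole mass.\<close>

lemma induced_fun_type1:
  assumes "H \<in> blocks G" "type1 G H" "v \<in> verts H" "\<not> cut_vertex G v"
  shows "induced_fun G f (BlockV H) = f v"
proof -
  obtain w where w: "verts H - cuts_in G H = {w}" using type1_noncut assms(1,2) by metis
  then have "v = w" using assms(3,4) by (auto simp: cuts_in_def)
  then show ?thesis by (simp only: induced_fun_BlockV[OF assms(1)] w) simp
qed

lemma induced_fun_type2:
  assumes "H \<in> blocks G" "\<forall>v\<in>verts H. \<not> cut_vertex G v \<longrightarrow> f v = 0"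
  shows "induced_fun G f (BlockV H) = 0"
  unfolding induced_fun_BlockV[OF assms(1)] using assms(2) by (intro sum.neutral) (auto simp: cuts_in_def)

text \<open>Serves condition 2 in both directions: type 0 leaves no vertex to carry mass, and in
  type 2 the mass vanishes by (L2).\<close>

lemma induced_fun_type0_type2:
  assumes "H \<in> blocks G" "type0 G H \<or> type2 G H"
    and "type2 G H \<Longrightarrow> \<forall>v\<in>verts H. \<not> cut_vertex G v \<longrightarrow> f v = 0"
  shows "induced_fun G f (BlockV H) = 0"
  using assms(2) induced_fun_type0[OF assms(1)] induced_fun_type2[OF assms(1) assms(3)] by (rule disjE)

section \<open>Domination by \<open>f\<close> against conditions 3 and 4 on \<open>g\<close>\<close>

text \<open>Used in both directions of the theorem. Cut-vertices are checked one by one and non-cut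
  vertices block by block, since those of one block all have the value
  \<open>g (BlockV H)\<close>.\<close>

lemma r2df_iff_bc_conditions:
  assumes g: "\<forall>x\<in>verts T. g x \<in> {0, 1, 2}" and ind: "\<forall>x\<in>verts T. g x = induced_fun G f x"
    and L1: "\<forall>H\<in>blocks G. type1 G H \<longrightarrow> (\<forall>v\<in>verts H. \<not> cut_vertex G v \<longrightarrow> f v \<in> {0, 1})"
    and L2: "\<forall>H\<in>blocks G. type2 G H \<longrightarrow> (\<forall>v\<in>verts H. \<not> cut_vertex G v \<longrightarrow> f v = 0)"
  shows "r2df G f \<longleftrightarrow>
     (\<forall>v. cut_vertex G v \<and> g (CutV v) = 0 \<longrightarrow>
         (\<exists>u\<in>verts T. u \<noteq> CutV v \<and> graph_dist T (CutV v) u \<le> 2 \<and> g u = 2) \<or>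
         (\<exists>u1\<in>verts T. \<exists>u2\<in>verts T. u1 \<noteq> u2 \<and> u1 \<noteq> CutV v \<and> u2 \<noteq> CutV v \<and>
            graph_dist T (CutV v) u1 \<le> 2 \<and> graph_dist T (CutV v) u2 \<le> 2 \<and>
            g u1 = 1 \<and> g u2 = 1)) \<and>
      (\<forall>H\<in>blocks G. (type1 G H \<or> type2 G H) \<and> g (BlockV H) = 0 \<longrightarrow>
         (\<exists>u\<in>nbhd T (BlockV H). g u = 2) \<or>
         (\<exists>u1\<in>nbhd T (BlockV H). \<exists>u2\<in>nbhd T (BlockV H). u1 \<noteq> u2 \<and> g u1 = 1 \<and> g u2 = 1))"
    (is "_ \<longleftrightarrow> (\<forall>v. _ \<longrightarrow> ?cut v) \<and> (\<forall>H\<in>_. _ \<longrightarrow> ?noncut H)")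
proof -
  have gC: "g (CutV v) = f v" if "cut_vertex G v" for v
    using ind that by (simp add: pverts_block_cutpoint_graph)
  have gB: "g (BlockV H) = induced_fun G f (BlockV H)" if "H \<in> blocks G" for H
    using ind that by (simp add: pverts_block_cutpoint_graph del: induced_fun.simps)
  have noncut_block: "\<exists>H\<in>blocks G. v \<in> verts H \<and> (type1 G H \<or> type2 G H)"
    if v: "v \<in> verts G" "\<not> cut_vertex G v" for v
  proof -
    obtain H where H: "H \<in> blocks G" "v \<in> verts H" using vert_in_block[OF v(1)] .
    then have "\<not> type0 G H" using type0_noncut[of H] v(2) by (auto simp: cuts_in_def)
    then show ?thesis using type_cases H by blast
  qed
  \<comment> \<open>In type 1, \<open>v\<close> carries the whole mass of the block; in type 2 both
    sides are 0 by (L2).\<close>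
  have gN: "g (BlockV H) = f v"
    if "H \<in> blocks G" "v \<in> verts H" "\<not> cut_vertex G v" "type1 G H \<or> type2 G H" for H v
    using that(4)
  proof
    assume "type1 G H"
    then show ?thesis unfolding gB[OF that(1)] using induced_fun_type1 that by metis
  next
    assume "type2 G H"
    then have "\<forall>v\<in>verts H. \<not> cut_vertex G v \<longrightarrow> f v = 0" using L2 that by blast
    then show ?thesis
      unfolding gB[OF that(1)] using induced_fun_type2[OF that(1)] that(2,3) by metis
  qed
  \<comment> \<open>The range comes from \<open>g\<close> at cut-vertices and from (L1), (L2)
    elsewhere, which leaves only the domination clause of \<open>r2df\<close>.\<close>
  have val: "f v \<in> {0, 1, 2}" if "v \<in> verts G" for v
  proof (cases "cut_vertex G v")
    case True
    then have "CutV v \<in> verts T" by (simp add: pverts_block_cutpoint_graph)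
    then have "g (CutV v) \<in> {0, 1, 2}" using g by blast
    then show ?thesis by (simp only: gC[OF True])
  next
    case False
    then obtain H where "H \<in> blocks G" "v \<in> verts H" "type1 G H \<or> type2 G H"
      using noncut_block \<open>v \<in> verts G\<close> by blast
    then show ?thesis using L1 L2 False by fastforce
  qed
  have "r2df G f \<longleftrightarrow> (\<forall>v\<in>verts G. f v = 0 \<longrightarrow> sum f (nbhd G v) \<ge> 2)"
    using val by (simp add: r2df_def)
  \<comment> \<open>The restriction to types 1 and 2 loses no vertex, by
    \<open>noncut_block\<close>.\<close>
  also have "\<dots> \<longleftrightarrow>
      (\<forall>v. cut_vertex G v \<and> f v = 0 \<longrightarrow> sum f (nbhd G v) \<ge> 2) \<and>
      (\<forall>H\<in>blocks G. \<forall>v\<in>verts H. \<not> cut_vertex G v \<and> (type1 G H \<or> type2 G H) \<and> f v = 0 \<longrightarrow>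
        sum f (nbhd G v) \<ge> 2)"
    (is "?all \<longleftrightarrow> ?all_cut \<and> ?all_noncut")
  proof (rule iffI)
    assume ?all
    then show "?all_cut \<and> ?all_noncut"
      using block_induced(1) by (fastforce simp: cut_vertex_def[of G])
  next
    assume *: "?all_cut \<and> ?all_noncut"
    show ?all
    proof (intro ballI impI)
      fix v assume v: "v \<in> verts G" "f v = 0"
      show "sum f (nbhd G v) \<ge> 2"
      proof (cases "cut_vertex G v")
        case True
        then show ?thesis using * v(2) by blast
      next
        case False
        then show ?thesis using * v(2) noncut_block[OF v(1)] by blast
      qed
    qed
  qed
  also have "(\<forall>v. cut_vertex G v \<and> f v = 0 \<longrightarrow> sum f (nbhd G v) \<ge> 2) \<longleftrightarrow>
      (\<forall>v. cut_vertex G v \<and> g (CutV v) = 0 \<longrightarrow> ?cut v)"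
  proof (rule iff_allI)
    fix v
    show "(cut_vertex G v \<and> f v = 0 \<longrightarrow> sum f (nbhd G v) \<ge> 2) \<longleftrightarrow>
      (cut_vertex G v \<and> g (CutV v) = 0 \<longrightarrow> ?cut v)"
    proof (cases "cut_vertex G v")
      case True
      show ?thesis unfolding gC[OF True] cut_domination_iff[OF True g ind] ..
    qed simp
  qed
  also have "(\<forall>H\<in>blocks G. \<forall>v\<in>verts H. \<not> cut_vertex G v \<and> (type1 G H \<or> type2 G H) \<and> f v = 0 \<longrightarrow>
        sum f (nbhd G v) \<ge> 2) \<longleftrightarrow>
      (\<forall>H\<in>blocks G. (type1 G H \<or> type2 G H) \<and> g (BlockV H) = 0 \<longrightarrow> ?noncut H)"
  proof (rule ball_cong[OF refl])
    fix H assume H: "H \<in> blocks G"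
    show "(\<forall>v\<in>verts H. \<not> cut_vertex G v \<and> (type1 G H \<or> type2 G H) \<and> f v = 0 \<longrightarrow>
        sum f (nbhd G v) \<ge> 2) \<longleftrightarrow>
      ((type1 G H \<or> type2 G H) \<and> g (BlockV H) = 0 \<longrightarrow> ?noncut H)"
    proof (cases "type1 G H \<or> type2 G H")
      case True
      \<comment> \<open>Condition 4 for \<open>H\<close> is extracted from domination at one non-cut
        vertex \<open>w\<close>, which types 1 and 2 guarantee.\<close>
      then obtain w where "w \<in> verts H - cuts_in G H"
      proof (elim disjE)
        assume "type1 G H"
        then obtain w where "verts H - cuts_in G H = {w}" using type1_noncut[OF H] by blast
        then show ?thesis using that[of w] by simp
      next
        assume "type2 G H"
        then show ?thesis using type2_noncut[OF H] that by blast
      qed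
      then have w: "w \<in> verts H" "\<not> cut_vertex G w" by (auto simp: cuts_in_def)
      have dom: "sum f (nbhd G v) \<ge> 2 \<longleftrightarrow> ?noncut H"
        if "v \<in> verts H" "\<not> cut_vertex G v" "g (BlockV H) = 0" for v
        using noncut_domination_iff[OF H that(1,2) g ind that(3)] .
      show ?thesis
      proof (intro iffI ballI impI; (elim conjE)?)
        assume *: "\<forall>v\<in>verts H. \<not> cut_vertex G v \<and> (type1 G H \<or> type2 G H) \<and> f v = 0 \<longrightarrow>
          sum f (nbhd G v) \<ge> 2" and zero: "g (BlockV H) = 0"
        then have "sum f (nbhd G w) \<ge> 2" using w True gN[OF H w True] by auto
        then show "?noncut H" using dom[OF w zero] by (rule iffD1[rotated])
      next
        fix v assume *: "(type1 G H \<or> type2 G H) \<and> g (BlockV H) = 0 \<longrightarrow> ?noncut H"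
          and v: "v \<in> verts H" "\<not> cut_vertex G v" "f v = 0"
        have zero: "g (BlockV H) = 0" using gN[OF H v(1,2) True] v(3) by simp
        show "sum f (nbhd G v) \<ge> 2"
          by (rule iffD2[OF dom[OF v(1,2) zero] mp[OF * conjI[OF True zero]]])
      qed
    qed simp
  qed
  finally show ?thesis .
qed

end

section \<open>Reading \<open>g\<close> off \<open>f\<close>, and rebuilding \<open>f\<close> from
  \<open>g\<close>\<close>

theorem theorem9:
  fixes G :: "('a,'b) pre_digraph"
    and T :: "(('a,'b) bc_vertex, ('a,'b) bc_vertex \<times> ('a,'b) bc_vertex) pre_digraph"
    and g :: "('a,'b) bc_vertex \<Rightarrow> nat"
  defines "T \<equiv> with_proj (block_cutpoint_graph G)"
  assumes "graph G" and "connected G" and "block_graph G" and "\<not> complete_graph G"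
    and "\<forall>x\<in>verts T. g x \<in> {0, 1, 2}"
  shows
    "(\<exists>f. r2df G f \<and> weight G f = gamma_R2 G \<and>
        (\<forall>H\<in>blocks G. type1 G H \<longrightarrow>
           (\<forall>v\<in>verts H. \<not> cut_vertex G v \<longrightarrow> f v \<in> {0, 1})) \<and>
        (\<forall>H\<in>blocks G. type2 G H \<longrightarrow>
           (\<forall>v\<in>verts H. \<not> cut_vertex G v \<longrightarrow> f v = 0)) \<and>
        (\<forall>x\<in>verts T. g x = induced_fun G f x))
     \<longleftrightarrow>
     ((\<forall>H\<in>blocks G. type1 G H \<longrightarrow> g (BlockV H) \<in> {0, 1}) \<and>
      (\<forall>H\<in>blocks G. type0 G H \<or> type2 G H \<longrightarrow> g (BlockV H) = 0) \<and>
      (\<forall>v. cut_vertex G v \<and> g (CutV v) = 0 \<longrightarrow>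
         (\<exists>u\<in>verts T. u \<noteq> CutV v \<and> graph_dist T (CutV v) u \<le> 2 \<and> g u = 2) \<or>
         (\<exists>u1\<in>verts T. \<exists>u2\<in>verts T. u1 \<noteq> u2 \<and> u1 \<noteq> CutV v \<and> u2 \<noteq> CutV v \<and>
            graph_dist T (CutV v) u1 \<le> 2 \<and> graph_dist T (CutV v) u2 \<le> 2 \<and>
            g u1 = 1 \<and> g u2 = 1)) \<and>
      (\<forall>H\<in>blocks G. (type1 G H \<or> type2 G H) \<and> g (BlockV H) = 0 \<longrightarrow>
         (\<exists>u\<in>nbhd T (BlockV H). g u = 2) \<or>
         (\<exists>u1\<in>nbhd T (BlockV H). \<exists>u2\<in>nbhd T (BlockV H). u1 \<noteq> u2 \<and> g u1 = 1 \<and> g u2 = 1)) \<and>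
      (\<Sum>x\<in>verts T. g x) = gamma_R2 G)"
proof -
  interpret connected_block_graph G
    using assms(2-4) by (simp add: connected_block_graph_def connected_block_graph_axioms_def)
  let ?T = "with_proj (block_cutpoint_graph G)"
  have g: "\<forall>x\<in>verts ?T. g x \<in> {0, 1, 2}"
    using assms(6) by (simp only: T_def)
  show ?thesis
  proof (unfold T_def, rule iffI, goal_cases)
    case 1
    then obtain f where f: "r2df G f" "weight G f = gamma_R2 G"
      and L1: "\<forall>H\<in>blocks G. type1 G H \<longrightarrow> (\<forall>v\<in>verts H. \<not> cut_vertex G v \<longrightarrow> f v \<in> {0, 1})"
      and L2: "\<forall>H\<in>blocks G. type2 G H \<longrightarrow> (\<forall>v\<in>verts H. \<not> cut_vertex G v \<longrightarrow> f v = 0)"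
      and ind: "\<forall>x\<in>verts ?T. g x = induced_fun G f x"
      by (elim exE conjE) (rule that)
    have gB: "g (BlockV H) = induced_fun G f (BlockV H)" if "H \<in> blocks G" for H
      using ind that by (simp add: pverts_block_cutpoint_graph del: induced_fun.simps)
    have c1: "g (BlockV H) \<in> {0, 1}" if H: "H \<in> blocks G" "type1 G H" for H
    proof -
      obtain w where "verts H - cuts_in G H = {w}" using type1_noncut[OF H] .
      then have w: "w \<in> verts H" "\<not> cut_vertex G w" by (auto simp: cuts_in_def)
      then have "f w \<in> {0, 1}" using L1 H by blast
      then show ?thesis unfolding gB[OF H(1)] induced_fun_type1[OF H w] .
    qed
    have c2: "g (BlockV H) = 0" if "H \<in> blocks G" "type0 G H \<or> type2 G H" for H
      unfolding gB[OF that(1)]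
      by (rule induced_fun_type0_type2[OF that L2[THEN bspec, THEN mp, OF that(1)]])
    have c5: "sum g (verts ?T) = gamma_R2 G"
      unfolding f(2)[symmetric] weight_induced[symmetric] using ind by (intro sum.cong) auto
    note c34 = r2df_iff_bc_conditions[OF g ind L1 L2, THEN iffD1, OF f(1)]
    have "\<forall>H\<in>blocks G. type1 G H \<longrightarrow> g (BlockV H) \<in> {0, 1}"
      "\<forall>H\<in>blocks G. type0 G H \<or> type2 G H \<longrightarrow> g (BlockV H) = 0"
      using c1 c2 by simp_all
    then show ?case
      by (intro conjI c34[THEN conjunct1] c34[THEN conjunct2] c5)
  next
    case b: 2
    note b1 = b[THEN conjunct1] and b2 = b[THEN conjunct2, THEN conjunct1]
      and b3 = b[THEN conjunct2, THEN conjunct2, THEN conjunct1]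
      and b4 = b[THEN conjunct2, THEN conjunct2, THEN conjunct2, THEN conjunct1]
      and b5 = b[THEN conjunct2, THEN conjunct2, THEN conjunct2, THEN conjunct2]
    \<comment> \<open>Cut-vertices copy their tree value, the mass of a type 1 block goes to its
      only non-cut vertex, and all other vertices get 0. The \<open>THE\<close> is reached only at
      non-cut vertices, whose block is unique.\<close>
    define f where "f v = (if cut_vertex G v then g (CutV v)
      else if \<exists>H\<in>blocks G. type1 G H \<and> v \<in> verts H
        then g (BlockV (THE H. H \<in> blocks G \<and> v \<in> verts H)) else 0)" for v
    have f_cut: "f v = g (CutV v)" if "cut_vertex G v" for v
      using that by (simp add: f_def)
    have f_noncut: "f v = (if type1 G H then g (BlockV H) else 0)"
      if "H \<in> blocks G" "v \<in> verts H" "\<not> cut_vertex G v" for H v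
    proof -
      have uniq: "H' = H" if "H' \<in> blocks G" "v \<in> verts H'" for H'
        using noncut_block_unique[OF connected block_graph] that
          \<open>H \<in> blocks G\<close> \<open>v \<in> verts H\<close> \<open>\<not> cut_vertex G v\<close> by metis
      have the: "(THE H. H \<in> blocks G \<and> v \<in> verts H) = H"
        using that uniq by blast
      have "(\<exists>H'\<in>blocks G. type1 G H' \<and> v \<in> verts H') \<longleftrightarrow> type1 G H"
        using that(1,2) uniq by blast
      then show ?thesis using that(3) by (simp add: f_def the)
    qed
    have L1: "\<forall>H\<in>blocks G. type1 G H \<longrightarrow> (\<forall>v\<in>verts H. \<not> cut_vertex G v \<longrightarrow> f v \<in> {0, 1})"
      using b1 f_noncut by simp
    \<comment> \<open>Types 1 and 2 exclude each other by cardinality, so the default 0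
      applies.\<close>
    have L2: "\<forall>H\<in>blocks G. type2 G H \<longrightarrow> (\<forall>v\<in>verts H. \<not> cut_vertex G v \<longrightarrow> f v = 0)"
      using f_noncut by (auto simp: type1_def type2_def)
    have ind: "\<forall>x\<in>verts ?T. g x = induced_fun G f x"
    proof
      fix x assume "x \<in> verts ?T"
      then consider v where "x = CutV v" "cut_vertex G v" | H where "x = BlockV H" "H \<in> blocks G"
        by (auto simp: pverts_block_cutpoint_graph)
      then show "g x = induced_fun G f x"
      proof cases
        case 1
        then show ?thesis by (simp add: f_cut)
      next
        case (2 H)
        show ?thesis
        proof (cases "type1 G H")
          case True
          obtain w where "verts H - cuts_in G H = {w}" using type1_noncut[OF 2(2) True] .
          then have w: "w \<in> verts H" "\<not> cut_vertex G w" by (auto simp: cuts_in_def)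
          show ?thesis
            unfolding 2(1) induced_fun_type1[OF 2(2) True w] using f_noncut[OF 2(2) w] True by simp
        next
          case False
          \<comment> \<open>Outside type 1 both sides are 0: \<open>g x\<close> by condition 2, the
            induced value by type 0 or (L2).\<close>
          then have ty: "type0 G H \<or> type2 G H" using type_cases 2(2) by blast
          have "g x = 0" unfolding 2(1) by (rule b2[rule_format, OF 2(2) ty])
          moreover have "induced_fun G f x = 0"
            unfolding 2(1)
            by (rule induced_fun_type0_type2[OF 2(2) ty L2[THEN bspec, THEN mp, OF 2(2)]])
          ultimately show ?thesis by simp
        qed
      qed
    qed
    have "r2df G f"
      using r2df_iff_bc_conditions[OF g ind L1 L2, THEN iffD2, OF conjI[OF b3 b4]] .
    moreover have "weight G f = gamma_R2 G"
    proof -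
      \<comment> \<open>Total mass is preserved, so condition 5 gives the weight of
        \<open>f\<close>.\<close>
      have "weight G f = sum g (verts ?T)"
        unfolding weight_induced[symmetric] using ind by (intro sum.cong) auto
      then show ?thesis using b5 by simp
    qed
    ultimately show ?case using L1 L2 ind by (intro exI[of _ f] conjI)
  qed
qed

end
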